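(* Let $q\ge 2$ be a power of $2$ and let $\mathcal{D}(q)$ be a quasi-symmetric design of Blokhuis-Haemers type. Let $G$ be an automorphism group of $\mathcal{D}(q)$ acting on $\mathcal{D}(q)$ with $f$ fixed points and $h$ fixed blocks, and all other orbits (of points and of blocks) of size $2$, and let $M$ be the point orbit matrix of $\mathcal{D}(q)$ with respect to $G$. Then the binary linear code spanned by the rows of the non-fixed part of the point orbit matrix $M$ is self-orthogonal. If $q\ge 4$, the code is doubly even.
   Context: A $2$-$(v,k,\lambda)$ design is a finite incidence structure $(\mathcal{P},\mathcal{B},\mathcal{I})$ with $v$ points, each block incident with exactly $k$ points, and any two distinct points incident with exactly $\lambda$ common blocks; it is symmetric if the number of blocks equals $v$. For $0\le s<k$, $s$ is a block intersection number if there are two blocks with exactly $s$ common points; the design is quasi-symmetric if it has exactly two block intersection numbers $x<y$. An automorphism group of a design $\mathcal{D}$ is a subgroup $G\le \mathrm{Aut}(\mathcal{D})$, acting on points and on blocks and preserving incidence. Designs of Blokhuis-Haemers type: let $q$ be a power of $2$. Let $\mathcal{D}_1$ be a symmetric $2$-$(q^2,q(q-1)/2,q(q-2)/4)$ design whose blocks are maximal arcs in the affine plane $AG(2,q)$ (sets of $q(q-1)/2$ points meeting every line in $0$ or $q/2$ points), and let $\mathcal{D}_2$ be the resolvable $2$-$(q^3,q,1)$ design of points and lines of $AG(3,q)$. For every parallel class $P$ of $q^2$ lines of $AG(3,q)$, label the lines in $P$ by the points of $\mathcal{D}_1$, and for each block $B$ of $\mathcal{D}_1$ define a block of the new design as the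 union of the $q(q-1)/2$ lines of $P$ labelled by the points of $B$; here the labelling is such that the sets of lines labelled by blocks of $\mathcal{D}_1$ are maximal arcs in the quotient affine plane $AG(2,q)$ whose points are the lines of $P$ (and whose lines are given by the planes of $AG(3,q)$ that are unions of lines of $P$). The points of the new design are the points of $AG(3,q)$, and its blocks are all the blocks obtained in this way from all parallel classes. The resulting design $\mathcal{D}(q)$ is called a design of Blokhuis-Haemers type. It is known (Blokhuis and Haemers) that $\mathcal{D}(q)$ is a quasi-symmetric $2$-$(q^3,\,q^2(q-1)/2,\,q(q^3-q^2-2)/4)$ design with block intersection numbers $x=q^2(q-2)/4$ and $y=q^2(q-1)/4$. Orbit matrices: let $\mathcal{P}_1,\dots,\mathcal{P}_{t_v}$ be the $G$-orbits of points and $\mathcal{B}_1,\dots,\mathcal{B}_{t_b}$ the $G$-orbits of blocks. The point orbit matrix with respect to $G$ is the $t_v\times t_b$ matrix $M=(\gamma_{ij})$, where $\gamma_{ij}$ is the number of blocks of $\mathcal{B}_j$ incident with a representative of $\mathcal{P}_i$ (independent of the representative). The non-fixed part of $M$ is the submatrix formed by the rows corresponding to non-fixed points (point orbits of size greater than $1$) and the columns corresponding to non-fixed blocks (block orbits of size greater than $1$); its entries are read in $\mathbb{F}_2$ (reduced modulo $2$). A binary code is doubly even if all codewords have weight divisible by $4$, and self-orthogonal if $C\subseteq C^\perp$ for the standard inner product. *)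

theory Defs
  imports
    "HOL-Analysis.Cartesian_Space"
    "HOL-Algebra.Group_Action"
    "HOL-Library.Z2"
    "Jordan_Normal_Form.VS_Connect"
    "Jordan_Normal_Form.DL_Submatrix"
begin

unbundle no vec_syntax

section \<open>Designs\<close>

record ('p, 'b) incidence_structure =
  points :: "'p set"
  blocks :: "'b set"
  incident :: "'p \<Rightarrow> 'b \<Rightarrow> bool"

definition set_structure :: "'p set \<Rightarrow> 'p set set \<Rightarrow> ('p, 'p set) incidence_structure" where
  "set_structure X \<B> = \<lparr>points = X, blocks = \<B>, incident = (\<in>)\<rparr>"

definition two_design :: "('p, 'b) incidence_structure \<Rightarrow> nat \<Rightarrow> nat \<Rightarrow> nat \<Rightarrow> bool" where
  "two_design D v k l \<longleftrightarrow>
     finite (points D) \<and> finite (blocks D) \<and> card (points D) = v \<and>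
     (\<forall>B\<in>blocks D. card {p \<in> points D. incident D p B} = k) \<and>
     (\<forall>p\<in>points D. \<forall>p'\<in>points D. p \<noteq> p' \<longrightarrow>
        card {B \<in> blocks D. incident D p B \<and> incident D p' B} = l)"

definition symmetric_design :: "('p, 'b) incidence_structure \<Rightarrow> nat \<Rightarrow> nat \<Rightarrow> nat \<Rightarrow> bool" where
  "symmetric_design D v k l \<longleftrightarrow> two_design D v k l \<and> card (blocks D) = v"

definition block_intersection_numbers :: "('p, 'b) incidence_structure \<Rightarrow> nat \<Rightarrow> nat set" where
  "block_intersection_numbers D k =
     {s. s < k \<and> (\<exists>B\<in>blocks D. \<exists>B'\<in>blocks D. B \<noteq> B' \<and>
                  card {p \<in> points D. incident D p B \<and> incident D p B'} = s)}"

definition quasi_symmetric_design :: "('p, 'b) incidence_structure \<Rightarrow> bool" where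
  "quasi_symmetric_design D \<longleftrightarrow>
     (\<exists>v k l. two_design D v k l \<and> card (block_intersection_numbers D k) = 2)"

section \<open>Designs of Blokhuis-Haemers type\<close>

text \<open>The affine geometry \<open>AG(n,q)\<close> has as points the vectors of \<open>'a ^ 'n\<close>, where \<open>'a\<close> is the
  field with \<open>q\<close> elements and \<open>n = CARD('n)\<close>.  Its flats of dimension \<open>d\<close> are the cosets of the
  subspaces of dimension \<open>d\<close>; in particular lines and planes are flats of dimension 1 and 2.\<close>

definition ag_flats :: "nat \<Rightarrow> ('a::field ^ 'n) set set" where
  "ag_flats d = {(+) p ` W | p W. vec.subspace W \<and> vec.dim W = d}"

definition parallel_classes :: "('a::field ^ 'n) set set set" where
  "parallel_classes = {range (\<lambda>p. (+) p ` W) | W. vec.subspace W \<and> vec.dim W = 1}"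

definition maximal_arc :: "nat \<Rightarrow> 'p set \<Rightarrow> 'p set set \<Rightarrow> 'p set \<Rightarrow> bool" where
  "maximal_arc q X \<L> A \<longleftrightarrow>
     A \<subseteq> X \<and> card A = q * (q - 1) div 2 \<and> (\<forall>L\<in>\<L>. card (A \<inter> L) \<in> {0, q div 2})"

text \<open>The quotient plane of \<open>AG(3,q)\<close> by a parallel class \<open>P\<close> has the members of \<open>P\<close> as its points.
  A plane that is a union of members of \<open>P\<close> is identified with the set of members it contains.\<close>

definition quotient_lines :: "('a::field ^ 3) set set \<Rightarrow> ('a ^ 3) set set set" where
  "quotient_lines P = {{L \<in> P. L \<subseteq> \<pi>} | \<pi>. \<pi> \<in> ag_flats 2 \<and> (\<exists>S\<subseteq>P. \<pi> = \<Union>S)}"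

text \<open>\<open>\<B>\<close> is the block set of the symmetric design on \<open>AG(2,q)\<close>, and \<open>\<phi> P x\<close> is the line of the
  parallel class \<open>P\<close> that is labelled by the point \<open>x\<close>.\<close>

definition blokhuis_haemers_type ::
  "('a::{field,finite} ^ 3, ('a ^ 3) set) incidence_structure \<Rightarrow> bool" where
  "blokhuis_haemers_type D \<longleftrightarrow>
     (let q = CARD('a) in
      \<exists>(\<B> :: ('a ^ 2) set set) (\<phi> :: ('a ^ 3) set set \<Rightarrow> 'a ^ 2 \<Rightarrow> ('a ^ 3) set).
        symmetric_design (set_structure UNIV \<B>) (q\<^sup>2) (q * (q - 1) div 2) (q * (q - 2) div 4) \<and>
        (\<forall>B\<in>\<B>. maximal_arc q UNIV (ag_flats 1) B) \<and>
        (\<forall>P\<in>parallel_classes. bij_betw (\<phi> P) UNIV P \<and>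
           (\<forall>B\<in>\<B>. maximal_arc q P (quotient_lines P) (\<phi> P ` B))) \<and>
        D = set_structure UNIV {\<Union>(\<phi> P ` B) | P B. P \<in> parallel_classes \<and> B \<in> \<B>})"

section \<open>Automorphism groups and orbit matrices\<close>

text \<open>An automorphism is a pair of a permutation of the points and a permutation of the blocks.\<close>

definition automorphism_group ::
  "('p, 'b) incidence_structure \<Rightarrow> (('p \<Rightarrow> 'p) \<times> ('b \<Rightarrow> 'b)) monoid" where
  "automorphism_group D =
     (BijGroup (points D) \<times>\<times> BijGroup (blocks D))
       \<lparr>carrier := {(\<alpha>, \<beta>). \<alpha> \<in> Bij (points D) \<and> \<beta> \<in> Bij (blocks D) \<and>
          (\<forall>p\<in>points D. \<forall>B\<in>blocks D. incident D (\<alpha> p) (\<beta> B) \<longleftrightarrow> incident D p B)}\<rparr>"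

definition point_orbits ::
  "('p, 'b) incidence_structure \<Rightarrow> (('p \<Rightarrow> 'p) \<times> ('b \<Rightarrow> 'b)) set \<Rightarrow> 'p set set" where
  "point_orbits D G = orbits (automorphism_group D\<lparr>carrier := G\<rparr>) (points D) fst"

definition block_orbits ::
  "('p, 'b) incidence_structure \<Rightarrow> (('p \<Rightarrow> 'p) \<times> ('b \<Rightarrow> 'b)) set \<Rightarrow> 'b set set" where
  "block_orbits D G = orbits (automorphism_group D\<lparr>carrier := G\<rparr>) (blocks D) snd"

definition fixed_points ::
  "('p, 'b) incidence_structure \<Rightarrow> (('p \<Rightarrow> 'p) \<times> ('b \<Rightarrow> 'b)) set \<Rightarrow> 'p set" where
  "fixed_points D G = {p \<in> points D. \<forall>g\<in>G. fst g p = p}"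

definition fixed_blocks ::
  "('p, 'b) incidence_structure \<Rightarrow> (('p \<Rightarrow> 'p) \<times> ('b \<Rightarrow> 'b)) set \<Rightarrow> 'b set" where
  "fixed_blocks D G = {B \<in> blocks D. \<forall>g\<in>G. snd g B = B}"

definition enumerates :: "'c list \<Rightarrow> 'c set \<Rightarrow> bool" where
  "enumerates xs A \<longleftrightarrow> distinct xs \<and> set xs = A"

text \<open>The lists \<open>Ps\<close> and \<open>Bs\<close> enumerate the orbits and so fix the order of rows and columns.  If
  they are the orbits of an automorphism group, the entries do not depend on the
  representative picked by \<open>SOME\<close>.\<close>

definition point_orbit_matrix ::
  "('p, 'b) incidence_structure \<Rightarrow> 'p set list \<Rightarrow> 'b set list \<Rightarrow> nat mat" where
  "point_orbit_matrix D Ps Bs =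
     mat (length Ps) (length Bs)
       (\<lambda>(i, j). card {B \<in> Bs ! j. incident D (SOME p. p \<in> Ps ! i) B})"

definition non_fixed_part :: "'p set list \<Rightarrow> 'b set list \<Rightarrow> nat mat \<Rightarrow> nat mat" where
  "non_fixed_part Ps Bs M =
     submatrix M {i. i < length Ps \<and> card (Ps ! i) > 1} {j. j < length Bs \<and> card (Bs ! j) > 1}"

section \<open>Binary codes\<close>

definition binary_row_code :: "nat mat \<Rightarrow> bit Matrix.vec set" where
  "binary_row_code N = vec_space.row_space (dim_col N) (map_mat of_nat N :: bit mat)"

definition dual_code :: "nat \<Rightarrow> bit Matrix.vec set \<Rightarrow> bit Matrix.vec set" where
  "dual_code n C = {w \<in> carrier_vec n. \<forall>c\<in>C. scalar_prod c w = 0}"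

definition self_orthogonal :: "nat \<Rightarrow> bit Matrix.vec set \<Rightarrow> bool" where
  "self_orthogonal n C \<longleftrightarrow> C \<subseteq> dual_code n C"

definition weight :: "bit Matrix.vec \<Rightarrow> nat" where
  "weight w = card {i. i < dim_vec w \<and> w $ i \<noteq> 0}"

definition doubly_even :: "bit Matrix.vec set \<Rightarrow> bool" where
  "doubly_even C \<longleftrightarrow> (\<forall>w\<in>C. 4 dvd weight w)"

end

theory Submission
  imports Defs
begin

text \<open>
  Orbits of length at most two let codeword entries be counted as blocks.  Let \<open>{p, p'}\<close> be a
  non-fixed point orbit and \<open>{B, B'}\<close> a non-fixed block orbit.  The entry at this position is odd
  iff exactly one of \<open>B\<close>, \<open>B'\<close> contains \<open>p\<close>.  An automorphism that swaps \<open>B\<close> and \<open>B'\<close> cannot fix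
  \<open>p\<close> then, so it swaps \<open>p\<close> and \<open>p'\<close>, and \<open>B\<close> contains exactly one of \<open>p\<close>, \<open>p'\<close>.  Conversely, a block
  that separates \<open>p\<close> from \<open>p'\<close> is moved by every automorphism swapping them, and its orbit gives an
  odd entry (\<open>odd_entry_iff\<close>).  Each such orbit has exactly one member that contains \<open>p\<close> but not
  \<open>p'\<close>, so the weight of the row is the number of blocks through \<open>p\<close> missing \<open>p'\<close>.

  In a 2-design this number is \<open>r - \<lambda>\<close>, where \<open>r\<close> blocks pass through \<open>p\<close>, and from
  \<open>r (k - 1) = \<lambda> (v - 1)\<close> follows \<open>(r - \<lambda>) (v - 1) = r (v - k)\<close>.  A common divisor \<open>d\<close> of \<open>v\<close> and
  \<open>k\<close> is coprime to \<open>v - 1\<close> and therefore divides \<open>r - \<lambda>\<close> (\<open>dvd_card_separating_blocks\<close>).  For a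
  design of Blokhuis-Haemers type \<open>v = q\<^sup>3\<close> and \<open>k = q\<^sup>2 (q - 1) / 2\<close>, so \<open>d = q\<^sup>2 / 2\<close> is possible.  It is
  even, and a multiple of 4 if \<open>q \<ge> 4\<close>.

  Two distinct rows, of \<open>{p, p'}\<close> and \<open>{s, s'}\<close>, are orthogonal for a reason of symmetry.  If any block
  orbit gives odd entries in both, an automorphism swapping its two blocks swaps both point pairs.
  Then equally many blocks contain \<open>p\<close>, \<open>p'\<close>, \<open>s\<close> as contain \<open>p\<close>, \<open>p'\<close>, \<open>s'\<close>.  Subtracting from \<open>\<lambda>\<close>, equally
  many of the blocks through \<open>p\<close> missing \<open>p'\<close> contain \<open>s\<close> as contain \<open>s'\<close>, and hence an even number of
  them contains exactly one of \<open>s\<close>, \<open>s'\<close> (\<open>even_common_separating_blocks\<close>).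

  Pairwise orthogonality and, given orthogonality, divisibility of weights by 4 both pass from the
  rows to their span.
\<close>

section \<open>Counting in 2-designs\<close>

definition separating_blocks :: "('p, 'b) incidence_structure \<Rightarrow> 'p \<Rightarrow> 'p \<Rightarrow> 'b set" where
  "separating_blocks D p p' = {B \<in> blocks D. incident D p B \<and> \<not> incident D p' B}"

lemma card_sym_diff_add_inter:
  assumes "finite A" and "finite B"
  shows "card {x \<in> A \<union> B. (x \<in> A) \<noteq> (x \<in> B)} + 2 * card (A \<inter> B) = card A + card B"
proof -
  have "{x \<in> A \<union> B. (x \<in> A) \<noteq> (x \<in> B)} = (A - B) \<union> (B - A)" by auto
  moreover have "card ((A - B) \<union> (B - A)) = card (A - B) + card (B - A)"
    by (rule card_Un_disjoint) (use assms in auto)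
  moreover have "card A = card (A - B) + card (A \<inter> B)"
    using card_Diff_subset_Int[of A B] assms card_mono[of A "A \<inter> B"] by simp
  moreover have "card B = card (B - A) + card (A \<inter> B)"
    using card_Diff_subset_Int[of B A] assms card_mono[of B "A \<inter> B"] by (simp add: Int_commute)
  ultimately show ?thesis by simp
qed

text \<open>Both sides count the incident pairs \<open>(s, B)\<close> with \<open>B\<close> a block through \<open>p\<close>: by blocks on the
  left, by points on the right, where the point \<open>p\<close> itself contributes the first summand.\<close>

lemma replication_identity:
  assumes "two_design D v k l" and "p \<in> points D"
  shows "card {B \<in> blocks D. incident D p B} * k = card {B \<in> blocks D. incident D p B} + (v - 1) * l"
proof -
  let ?R = "{B \<in> blocks D. incident D p B}"
  have fin: "finite (points D)" "finite ?R" and v: "card (points D) = v"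
    using assms by (auto simp: two_design_def)
  have "(\<Sum>s\<in>points D. card {B \<in> ?R. incident D s B}) = k * card ?R"
    by (rule sum_multicount) (use assms fin in \<open>auto simp: two_design_def\<close>)
  moreover have "(\<Sum>s\<in>points D. card {B \<in> ?R. incident D s B})
      = card {B \<in> ?R. incident D p B} + (\<Sum>s\<in>points D - {p}. card {B \<in> ?R. incident D s B})"
    using fin assms(2) by (simp add: sum.remove)
  moreover have "(\<Sum>s\<in>points D - {p}. card {B \<in> ?R. incident D s B}) = (\<Sum>s\<in>points D - {p}. l)"
    by (rule sum.cong) (use assms in \<open>auto simp: two_design_def\<close>)
  moreover have "{B \<in> ?R. incident D p B} = ?R" by auto
  ultimately show ?thesis using fin assms(2) v by (simp add: mult.commute)
qed

lemma card_separating_blocks_add: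
  assumes "two_design D v k l" and "p \<in> points D" and "p' \<in> points D" and "p \<noteq> p'"
  shows "card (separating_blocks D p p') + l = card {B \<in> blocks D. incident D p B}"
proof -
  let ?T = "{B \<in> blocks D. incident D p B \<and> incident D p' B}"
  have "{B \<in> blocks D. incident D p B} = separating_blocks D p p' \<union> ?T"
    by (auto simp: separating_blocks_def)
  moreover have "card (separating_blocks D p p' \<union> ?T) = card (separating_blocks D p p') + card ?T"
    by (rule card_Un_disjoint) (use assms in \<open>auto simp: two_design_def separating_blocks_def\<close>)
  moreover have "card ?T = l" using assms by (auto simp: two_design_def)
  ultimately show ?thesis by simp
qed

text \<open>The number \<open>n = r - l\<close> of separating blocks satisfies \<open>n * (v - 1) = r * (v - k)\<close>.  A divisor \<open>d\<close>
  of \<open>v\<close> is coprime to \<open>v - 1\<close>, so \<open>d\<close> divides \<open>n\<close> as soon as it divides the right-hand side.  This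
  avoids computing \<open>r\<close> and \<open>l\<close>, and with them the number of blocks.\<close>

lemma dvd_card_separating_blocks:
  assumes D: "two_design D v k l" and p: "p \<in> points D" "p' \<in> points D" "p \<noteq> p'"
    and dv: "d dvd v" and dk: "d dvd k"
  shows "d dvd card (separating_blocks D p p')"
proof -
  define n where "n = card (separating_blocks D p p')"
  define r where "r = card {B \<in> blocks D. incident D p B}"
  have r: "r = n + l" using card_separating_blocks_add[OF D p] by (simp add: r_def n_def)
  have rk: "r * k = r + (v - 1) * l" using replication_identity[OF D p(1)] by (simp add: r_def)
  have v: "v > 0" using D p(1) by (auto simp: two_design_def card_gt_0_iff)
  have "n * (v - 1) + r * k = r * v"
    unfolding rk using v by (cases v) (simp_all add: r algebra_simps)
  then have "d dvd n * (v - 1)"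
    using dv dk by (metis dvd_add_left_iff dvd_mult)
  moreover have "coprime d (v - 1)"
    using dv v by (metis coprime_diff_one_right_nat coprime_divisors dvd_refl)
  ultimately show ?thesis by (simp add: n_def coprime_dvd_mult_left_iff)
qed

section \<open>Automorphism groups with orbits of length at most two\<close>

text \<open>The incidence-preserving pairs form a subgroup of the product of the two symmetric groups; this
  makes the theory of group actions available for \<open>G\<close>.\<close>

lemma group_automorphism_group:
  assumes "subgroup G (automorphism_group D)"
  shows "group (automorphism_group D\<lparr>carrier := G\<rparr>)"
proof -
  let ?H = "BijGroup (points D) \<times>\<times> BijGroup (blocks D)"
  let ?S = "{(\<alpha>, \<beta>). \<alpha> \<in> Bij (points D) \<and> \<beta> \<in> Bij (blocks D) \<and>
          (\<forall>p\<in>points D. \<forall>B\<in>blocks D. incident D (\<alpha> p) (\<beta> B) \<longleftrightarrow> incident D p B)}"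
  have gp: "group (BijGroup (points D))" and gb: "group (BijGroup (blocks D))"
    by (simp_all add: group_BijGroup)
  interpret H: group ?H using gp gb by (rule DirProd_group)
  have "subgroup ?S ?H"
  proof (rule H.subgroupI)
    show "?S \<subseteq> carrier ?H" by (auto simp: DirProd_def BijGroup_def)
    have "(\<lambda>x\<in>points D. x, \<lambda>x\<in>blocks D. x) \<in> ?S" by (auto simp: id_Bij)
    then show "?S \<noteq> {}" by blast
  next
    fix a assume a: "a \<in> ?S"
    obtain \<alpha> \<beta> where ab: "a = (\<alpha>, \<beta>)" "\<alpha> \<in> Bij (points D)" "\<beta> \<in> Bij (blocks D)"
      and inc: "\<And>p B. p \<in> points D \<Longrightarrow> B \<in> blocks D \<Longrightarrow> incident D (\<alpha> p) (\<beta> B) \<longleftrightarrow> incident D p B"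
      using a by auto
    let ?\<alpha> = "\<lambda>x\<in>points D. inv_into (points D) \<alpha> x" and ?\<beta> = "\<lambda>x\<in>blocks D. inv_into (blocks D) \<beta> x"
    have inv: "inv\<^bsub>?H\<^esub> a = (?\<alpha>, ?\<beta>)"
    proof -
      have "\<alpha> \<in> carrier (BijGroup (points D))" "\<beta> \<in> carrier (BijGroup (blocks D))"
        using ab by (simp_all add: BijGroup_def)
      then show ?thesis
        using inv_DirProd[OF gp gb] inv_BijGroup ab by metis
    qed
    have "incident D (?\<alpha> p) (?\<beta> B) \<longleftrightarrow> incident D p B" if "p \<in> points D" "B \<in> blocks D" for p B
    proof -
      have im: "\<alpha> ` points D = points D" "\<beta> ` blocks D = blocks D"
        using ab by (auto simp: Bij_def bij_betw_def)
      have "?\<alpha> p \<in> points D" "\<alpha> (?\<alpha> p) = p" "?\<beta> B \<in> blocks D" "\<beta> (?\<beta> B) = B"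
        using that im by (auto simp: inv_into_into f_inv_into_f)
      then show ?thesis using inc by metis
    qed
    then show "inv\<^bsub>?H\<^esub> a \<in> ?S"
      unfolding inv
      by (intro CollectI case_prodI conjI ballI restrict_inv_into_Bij ab)
  next
    fix a b assume "a \<in> ?S" "b \<in> ?S"
    then show "a \<otimes>\<^bsub>?H\<^esub> b \<in> ?S"
      by (auto simp: DirProd_def BijGroup_def compose_Bij compose_eq Bij_imp_funcset[THEN funcset_mem])
  qed
  then have "group (?H\<lparr>carrier := ?S\<rparr>)"
    using H.subgroup_imp_group by blast
  then have "group (automorphism_group D)" by (simp add: automorphism_group_def)
  then show ?thesis using assms group.subgroup_imp_group by blast
qed

lemma automorphism_groupD:
  assumes "subgroup G (automorphism_group D)" and "g \<in> G"
  shows "fst g \<in> Bij (points D)" and "snd g \<in> Bij (blocks D)"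
    and "\<And>p B. p \<in> points D \<Longrightarrow> B \<in> blocks D \<Longrightarrow> incident D (fst g p) (snd g B) \<longleftrightarrow> incident D p B"
  using subgroup.subset[OF assms(1)] assms(2) by (auto simp: automorphism_group_def)

lemma group_action_points:
  assumes "subgroup G (automorphism_group D)"
  shows "group_action (automorphism_group D\<lparr>carrier := G\<rparr>) (points D) fst"
proof -
  have "fst \<in> hom (automorphism_group D\<lparr>carrier := G\<rparr>) (BijGroup (points D))"
  proof (rule homI)
    fix x y assume "x \<in> carrier (automorphism_group D\<lparr>carrier := G\<rparr>)"
      "y \<in> carrier (automorphism_group D\<lparr>carrier := G\<rparr>)"
    then show "fst (x \<otimes>\<^bsub>automorphism_group D\<lparr>carrier := G\<rparr>\<^esub> y) = fst x \<otimes>\<^bsub>BijGroup (points D)\<^esub> fst y"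
      by (auto simp: automorphism_group_def DirProd_def split: prod.splits)
  qed (use automorphism_groupD[OF assms] in \<open>auto simp: BijGroup_def\<close>)
  then show ?thesis
    using group_automorphism_group[OF assms] group_BijGroup
    by (auto simp: group_action_def group_hom_def group_hom_axioms_def)
qed

lemma group_action_blocks:
  assumes "subgroup G (automorphism_group D)"
  shows "group_action (automorphism_group D\<lparr>carrier := G\<rparr>) (blocks D) snd"
proof -
  have "snd \<in> hom (automorphism_group D\<lparr>carrier := G\<rparr>) (BijGroup (blocks D))"
  proof (rule homI)
    fix x y assume "x \<in> carrier (automorphism_group D\<lparr>carrier := G\<rparr>)"
      "y \<in> carrier (automorphism_group D\<lparr>carrier := G\<rparr>)"
    then show "snd (x \<otimes>\<^bsub>automorphism_group D\<lparr>carrier := G\<rparr>\<^esub> y) = snd x \<otimes>\<^bsub>BijGroup (blocks D)\<^esub> snd y"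
      by (auto simp: automorphism_group_def DirProd_def split: prod.splits)
  qed (use automorphism_groupD[OF assms] in \<open>auto simp: BijGroup_def\<close>)
  then show ?thesis
    using group_automorphism_group[OF assms] group_BijGroup
    by (auto simp: group_action_def group_hom_def group_hom_axioms_def)
qed

lemma (in group_action) orbits_eq_orbit:
  assumes "\<O> \<in> orbits G E \<phi>" and "a \<in> \<O>"
  shows "a \<in> E" and "\<O> = orbit G \<phi> a"
proof -
  obtain x where x: "x \<in> E" "\<O> = orbit G \<phi> x" using assms(1) by (auto simp: orbits_def)
  show a: "a \<in> E" using assms x element_image by (auto simp: orbit_def)
  have sub: "y \<in> E" if "y \<in> orbit G \<phi> z" "z \<in> E" for y z
    using that element_image by (auto simp: orbit_def)
  show "\<O> = orbit G \<phi> a"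
    using orbit_trans orbit_sym a x assms(2) sub by blast
qed

text \<open>A group element permutes the orbit, and a set of two elements has only two permutations.\<close>

lemma (in group_action) two_orbit_fix_or_swap:
  assumes "{a, b} \<in> orbits G E \<phi>" and "a \<noteq> b" and "g \<in> carrier G"
  shows "\<phi> g a = a \<and> \<phi> g b = b \<or> \<phi> g a = b \<and> \<phi> g b = a"
proof -
  have E: "a \<in> E" "b \<in> E" and o: "{a, b} = orbit G \<phi> a" "{a, b} = orbit G \<phi> b"
    using orbits_eq_orbit[OF assms(1)] by auto
  have "\<phi> g a \<in> {a, b}" using o(1) assms(3) by (auto simp: orbit_def)
  moreover have "\<phi> g b \<in> {a, b}" using o(2) assms(3) by (auto simp: orbit_def)
  moreover have "\<phi> g a \<noteq> \<phi> g b"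
    using inj_prop[OF assms(3)] E assms(2) by (auto simp: inj_on_def)
  ultimately show ?thesis by auto
qed

lemma (in group_action) two_orbit_swap:
  assumes "{a, b} \<in> orbits G E \<phi>" and "a \<noteq> b"
  obtains g where "g \<in> carrier G" and "\<phi> g a = b" and "\<phi> g b = a"
proof -
  have "b \<in> orbit G \<phi> a" using orbits_eq_orbit[OF assms(1), of a] by auto
  then obtain g where "g \<in> carrier G" "\<phi> g a = b" by (auto simp: orbit_def)
  then show ?thesis using two_orbit_fix_or_swap[OF assms] assms(2) that by metis
qed

lemma card_2_other:
  assumes "card A = 2" and "a \<in> A"
  obtains b where "A = {a, b}" and "a \<noteq> b"
proof -
  obtain x y where "A = {x, y}" "x \<noteq> y" using assms(1) by (auto simp: card_2_iff)
  then show ?thesis using assms(2) that[of x] that[of y] by blast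
qed

locale automorphism_group_short_block_orbits =
  fixes D :: "('p, 'b) incidence_structure"
    and G :: "(('p \<Rightarrow> 'p) \<times> ('b \<Rightarrow> 'b)) set"
  assumes subgroup: "subgroup G (automorphism_group D)"
    and block_orbit_card: "\<O> \<in> block_orbits D G \<Longrightarrow> card \<O> \<noteq> 1 \<Longrightarrow> card \<O> = 2"
begin

sublocale pt: group_action "automorphism_group D\<lparr>carrier := G\<rparr>" "points D" fst
  by (rule group_action_points[OF subgroup])

sublocale bl: group_action "automorphism_group D\<lparr>carrier := G\<rparr>" "blocks D" snd
  by (rule group_action_blocks[OF subgroup])

abbreviation block_orbit :: "'b \<Rightarrow> 'b set" where
  "block_orbit B \<equiv> orbit (automorphism_group D\<lparr>carrier := G\<rparr>) snd B"

abbreviation nonfixed_block_orbits :: "'b set set" where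
  "nonfixed_block_orbits \<equiv> {\<O> \<in> block_orbits D G. card \<O> > 1}"

lemma incident_image:
  "g \<in> G \<Longrightarrow> p \<in> points D \<Longrightarrow> B \<in> blocks D \<Longrightarrow> incident D (fst g p) (snd g B) \<longleftrightarrow> incident D p B"
  using automorphism_groupD[OF subgroup] by blast

lemmas point_orbit_subset = pt.orbits_eq_orbit(1)[folded point_orbits_def]
lemmas block_orbit_subset = bl.orbits_eq_orbit(1)[folded block_orbits_def]
lemmas block_orbit_eq = bl.orbits_eq_orbit(2)[folded block_orbits_def]

lemma point_orbit_fix_or_swap:
  assumes "{p, p'} \<in> point_orbits D G" and "p \<noteq> p'" and "g \<in> G"
  shows "fst g p = p \<and> fst g p' = p' \<or> fst g p = p' \<and> fst g p' = p"
  using pt.two_orbit_fix_or_swap[of p p' g] assms by (simp add: point_orbits_def)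

lemma point_orbit_swap:
  assumes "{p, p'} \<in> point_orbits D G" and "p \<noteq> p'"
  obtains g where "g \<in> G" and "fst g p = p'" and "fst g p' = p"
proof (rule pt.two_orbit_swap[OF assms[unfolded point_orbits_def]])
  fix g assume "g \<in> carrier (automorphism_group D\<lparr>carrier := G\<rparr>)" and "fst g p = p'" and "fst g p' = p"
  then show thesis using that[of g] by simp
qed

lemma block_orbit_swap:
  assumes "{B, B'} \<in> block_orbits D G" and "B \<noteq> B'"
  obtains g where "g \<in> G" and "snd g B = B'" and "snd g B' = B"
proof (rule bl.two_orbit_swap[OF assms[unfolded block_orbits_def]])
  fix g assume "g \<in> carrier (automorphism_group D\<lparr>carrier := G\<rparr>)" and "snd g B = B'" and "snd g B' = B"
  then show thesis using that[of g] by simp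
qed

lemma image_in_block_orbit:
  assumes "g \<in> G"
  shows "snd g B \<in> block_orbit B"
  unfolding orbit_def using assms by (intro CollectI exI[of _ g]) simp

lemma nonfixed_block_orbit_eq:
  assumes "\<O> \<in> nonfixed_block_orbits" and "B \<in> \<O>"
  obtains B' where "\<O> = {B, B'}" and "B \<noteq> B'" and "B \<in> blocks D" and "B' \<in> blocks D"
proof -
  have "card \<O> = 2" using assms block_orbit_card by force
  then obtain B' where B': "\<O> = {B, B'}" "B \<noteq> B'"
    using assms(2) by (rule card_2_other)
  have "\<O> \<subseteq> blocks D" using assms(1) block_orbit_subset by blast
  then show ?thesis using that[of B'] B' by blast
qed

text \<open>An automorphism \<open>g\<close> that swaps \<open>p\<close> and \<open>p'\<close> sends a block separating them to one that separates
  them the other way round.  So \<open>g\<close> moves the block, and its image is the second member of the orbit.\<close>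

lemma separating_block_orbit:
  assumes pp: "{p, p'} \<in> point_orbits D G" "p \<noteq> p'"
    and B: "B \<in> blocks D" "incident D p B \<noteq> incident D p' B"
  shows "block_orbit B \<in> nonfixed_block_orbits"
    and "\<exists>B'. block_orbit B = {B, B'} \<and> incident D p B' = incident D p' B"
proof -
  have pts: "p \<in> points D" "p' \<in> points D"
    using point_orbit_subset[OF pp(1)] by simp_all
  obtain g where g: "g \<in> G" "fst g p = p'" "fst g p' = p"
    using point_orbit_swap[OF pp] .
  let ?B' = "snd g B"
  have inc: "incident D p ?B' = incident D p' B"
    using incident_image[OF g(1) pts(2) B(1)] g by simp
  then have ne: "?B' \<noteq> B" using B(2) by auto
  have orb: "block_orbit B \<in> block_orbits D G"
    using B(1) by (auto simp: block_orbits_def orbits_def)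
  have mem: "B \<in> block_orbit B" "?B' \<in> block_orbit B"
    using bl.orbit_refl[OF B(1)] image_in_block_orbit[OF g(1)] by blast+
  have "card (block_orbit B) \<noteq> 1" using mem ne by (metis card_1_singletonE singletonD)
  then have c2: "card (block_orbit B) = 2" using orb block_orbit_card by blast
  then show "block_orbit B \<in> nonfixed_block_orbits" using orb by simp
  have "block_orbit B = {B, ?B'}" using card_2_other[OF c2 mem(1)] mem(2) ne by blast
  then show "\<exists>B'. block_orbit B = {B, B'} \<and> incident D p B' = incident D p' B"
    using inc by blast
qed

text \<open>An odd entry means that \<open>p\<close> lies on just one of the two blocks \<open>B\<close>, \<open>B'\<close> of the orbit.  An
  automorphism swapping \<open>B\<close> and \<open>B'\<close> then moves \<open>p\<close> to \<open>p'\<close>, which transports incidence of \<open>p\<close> with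
  \<open>B'\<close> to incidence of \<open>p'\<close> with \<open>B\<close>.  The converse is \<open>separating_block_orbit\<close>.\<close>

lemma odd_entry_iff:
  assumes pp: "{p, p'} \<in> point_orbits D G" "p \<noteq> p'"
    and \<O>: "\<O> \<in> nonfixed_block_orbits" "B \<in> \<O>"
  shows "odd (card {C \<in> \<O>. incident D p C}) \<longleftrightarrow> incident D p B \<noteq> incident D p' B"
proof -
  obtain B' where B': "\<O> = {B, B'}" "B \<noteq> B'" and bb: "B \<in> blocks D" "B' \<in> blocks D"
    using nonfixed_block_orbit_eq[OF \<O>] .
  have pts: "p \<in> points D" "p' \<in> points D"
    using point_orbit_subset[OF pp(1)] by simp_all
  have "{C \<in> \<O>. incident D p C} = (if incident D p B then {B} else {}) \<union> (if incident D p B' then {B'} else {})"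
    using B' by auto
  then have 1: "odd (card {C \<in> \<O>. incident D p C}) \<longleftrightarrow> incident D p B \<noteq> incident D p B'"
    using B'(2) by auto
  have 2: "incident D p' B = incident D p B'" if ne: "incident D p B \<noteq> incident D p B'"
  proof -
    obtain h where h: "h \<in> G" "snd h B = B'" "snd h B' = B"
      using block_orbit_swap[of B B'] \<O>(1) B' by blast
    have "fst h p \<noteq> p" using incident_image[OF h(1) pts(1) bb(1)] h ne by auto
    then have "fst h p = p'"
      using point_orbit_fix_or_swap[OF pp h(1)] by blast
    then show ?thesis using incident_image[OF h(1) pts(1) bb(2)] h by simp
  qed
  have 3: "incident D p B' = incident D p' B" if "incident D p B \<noteq> incident D p' B"
  proof -
    have "\<O> = block_orbit B" using \<O> block_orbit_eq by blast
    then show ?thesis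
      using separating_block_orbit(2)[OF pp bb(1) that] B' by (auto simp: doubleton_eq_iff)
  qed
  show ?thesis using 1 2 3 by blast
qed

text \<open>The two blocks of an orbit with an odd entry separate \<open>p\<close> and \<open>p'\<close> in opposite ways, so just one of
  them contains \<open>p\<close> and misses \<open>p'\<close>.  This turns counts of odd matrix entries into counts of blocks.\<close>

lemma bij_betw_separating_blocks:
  assumes pp: "{p, p'} \<in> point_orbits D G" "p \<noteq> p'"
  shows "bij_betw block_orbit (separating_blocks D p p')
           {\<O> \<in> nonfixed_block_orbits. odd (card {C \<in> \<O>. incident D p C})}"
proof -
  have orb: "block_orbit B \<in> nonfixed_block_orbits \<and> B \<in> block_orbit B"
    if "B \<in> separating_blocks D p p'" for B
  proof -
    have B: "B \<in> blocks D" "incident D p B \<noteq> incident D p' B"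
      using that by (simp_all add: separating_blocks_def)
    show ?thesis using separating_block_orbit(1)[OF pp B] bl.orbit_refl[OF B(1)] by blast
  qed
  have eq: "{C \<in> block_orbit B. incident D p C} = {B}" if B: "B \<in> separating_blocks D p p'" for B
  proof -
    have B': "B \<in> blocks D" "incident D p B \<noteq> incident D p' B"
      using B by (simp_all add: separating_blocks_def)
    then obtain B' where "block_orbit B = {B, B'}" "incident D p B' = incident D p' B"
      using separating_block_orbit(2)[OF pp B'] by blast
    moreover have "incident D p B" "\<not> incident D p' B"
      using B by (simp_all add: separating_blocks_def)
    ultimately show ?thesis by blast
  qed
  show ?thesis
  proof (rule bij_betwI')
    fix B C assume BC: "B \<in> separating_blocks D p p'" "C \<in> separating_blocks D p p'"
    show "(block_orbit B = block_orbit C) = (B = C)"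
    proof
      assume "block_orbit B = block_orbit C"
      then have "{B} = {C}" by (simp only: eq[OF BC(1), symmetric] eq[OF BC(2), symmetric])
      then show "B = C" by simp
    qed simp
  next
    fix B assume B: "B \<in> separating_blocks D p p'"
    have "odd (card {C \<in> block_orbit B. incident D p C})" unfolding eq[OF B] by simp
    then show "block_orbit B \<in> {\<O> \<in> nonfixed_block_orbits. odd (card {C \<in> \<O>. incident D p C})}"
      using orb[OF B] by blast
  next
    fix \<O> assume \<O>: "\<O> \<in> {\<O> \<in> nonfixed_block_orbits. odd (card {C \<in> \<O>. incident D p C})}"
    then have "{C \<in> \<O>. incident D p C} \<noteq> {}" by (metis (lifting) mem_Collect_eq card.empty even_zero)
    then obtain B where B: "B \<in> \<O>" "incident D p B" by blast
    have "\<O> \<in> nonfixed_block_orbits" "odd (card {C \<in> \<O>. incident D p C})" using \<O> by simp_all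
    then have "\<not> incident D p' B" using odd_entry_iff[OF pp _ B(1)] B(2) by simp
    moreover have "B \<in> blocks D" "\<O> = block_orbit B"
      using \<O> B(1) block_orbit_subset[of \<O> B] block_orbit_eq[of \<O> B] by simp_all
    ultimately show "\<exists>B\<in>separating_blocks D p p'. \<O> = block_orbit B"
      using B(2) by (intro bexI[of _ B]) (simp_all add: separating_blocks_def)
  qed
qed

lemma card_odd_entries:
  assumes "{p, p'} \<in> point_orbits D G" and "p \<noteq> p'"
  shows "card {\<O> \<in> nonfixed_block_orbits. odd (card {C \<in> \<O>. incident D p C})}
           = card (separating_blocks D p p')"
  by (rule bij_betw_same_card[OF bij_betw_separating_blocks[OF assms], symmetric])

lemma card_common_odd_entries:
  assumes pp: "{p, p'} \<in> point_orbits D G" "p \<noteq> p'" and ss: "{s, s'} \<in> point_orbits D G" "s \<noteq> s'"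
  shows "card {\<O> \<in> nonfixed_block_orbits. odd (card {C \<in> \<O>. incident D p C}) \<and>
                 odd (card {C \<in> \<O>. incident D s C})}
           = card {B \<in> separating_blocks D p p'. incident D s B \<noteq> incident D s' B}"
proof -
  note bij = bij_betw_separating_blocks[OF pp]
  let ?X = "{B \<in> separating_blocks D p p'. incident D s B \<noteq> incident D s' B}"
  let ?Y = "{\<O> \<in> nonfixed_block_orbits. odd (card {C \<in> \<O>. incident D p C}) \<and>
                 odd (card {C \<in> \<O>. incident D s C})}"
  have iff: "odd (card {C \<in> block_orbit B. incident D s C}) \<longleftrightarrow> incident D s B \<noteq> incident D s' B"
    if B: "B \<in> separating_blocks D p p'" for B
  proof (rule odd_entry_iff[OF ss])
    show "block_orbit B \<in> nonfixed_block_orbits"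
      using bij_betwE[OF bij, THEN bspec, OF B] by simp
    show "B \<in> block_orbit B"
      by (rule bl.orbit_refl) (use B in \<open>simp add: separating_blocks_def\<close>)
  qed
  have "block_orbit ` ?X = ?Y"
  proof
    show "block_orbit ` ?X \<subseteq> ?Y"
    proof (rule image_subsetI)
      fix B assume "B \<in> ?X"
      then have B: "B \<in> separating_blocks D p p'" "incident D s B \<noteq> incident D s' B" by simp_all
      show "block_orbit B \<in> ?Y"
        using bij_betwE[OF bij, THEN bspec, OF B(1)] iff[OF B(1)] B(2) by simp
    qed
    show "?Y \<subseteq> block_orbit ` ?X"
    proof
      fix \<O> assume \<O>: "\<O> \<in> ?Y"
      then have "\<O> \<in> block_orbit ` separating_blocks D p p'"
        unfolding bij_betw_imp_surj_on[OF bij] by simp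
      then obtain B where "B \<in> separating_blocks D p p'" "\<O> = block_orbit B"
        by (rule imageE)
      moreover from this have "incident D s B \<noteq> incident D s' B" using iff \<O> by simp
      ultimately show "\<O> \<in> block_orbit ` ?X" by (intro image_eqI[of _ _ B]) simp_all
    qed
  qed
  moreover have "card (block_orbit ` ?X) = card ?X"
    by (intro card_image inj_on_subset[OF bij_betw_imp_inj_on[OF bij]]) blast
  ultimately show ?thesis by (rule subst)
qed

text \<open>If there is a block \<open>B\<close> to count, its orbit supplies an automorphism \<open>h\<close> that swaps \<open>p\<close>, \<open>p'\<close> and
  \<open>s\<close>, \<open>s'\<close> simultaneously.  Applying \<open>h\<close> shows that as many blocks contain \<open>p\<close>, \<open>p'\<close>, \<open>s\<close> as contain \<open>p\<close>,
  \<open>p'\<close>, \<open>s'\<close>.  Taking complements within the \<open>l\<close> blocks through \<open>p\<close> and \<open>s\<close>, or \<open>p\<close> and \<open>s'\<close>, makes the sets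
  of separating blocks through \<open>s\<close> and through \<open>s'\<close> equally large.  The symmetric difference of two
  finite sets of equal size has even size.\<close>

lemma even_common_separating_blocks:
  assumes D: "two_design D v k l"
    and pp: "{p, p'} \<in> point_orbits D G" "p \<noteq> p'" and ss: "{s, s'} \<in> point_orbits D G" "s \<noteq> s'"
    and ne: "{p, p'} \<noteq> {s, s'}"
  shows "even (card {B \<in> separating_blocks D p p'. incident D s B \<noteq> incident D s' B})"
    (is "even (card ?X)")
proof (cases "?X = {}")
  case False
  then obtain B where B: "B \<in> ?X" by blast
  have pts: "p \<in> points D" "p' \<in> points D" "s \<in> points D" "s' \<in> points D"
    using point_orbit_subset[OF pp(1)] point_orbit_subset[OF ss(1)] by simp_all
  have dist: "p \<noteq> s" "p \<noteq> s'" "p' \<noteq> s" "p' \<noteq> s'"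
    using ne pp(1) ss(1) pt.orbits_eq_orbit(2)[of "{p, p'}"] pt.orbits_eq_orbit(2)[of "{s, s'}"]
    unfolding point_orbits_def by blast+
  have fin: "finite (blocks D)" using D by (simp add: two_design_def)
  have Bb: "B \<in> blocks D" and Bp: "incident D p B \<noteq> incident D p' B"
    and Bs: "incident D s B \<noteq> incident D s' B"
    using B by (auto simp: separating_blocks_def)
  note non = separating_block_orbit(1)[OF pp Bb Bp]
  have mem: "B \<in> block_orbit B" using bl.orbit_refl[OF Bb] .
  obtain B' where B': "block_orbit B = {B, B'}" "B \<noteq> B'" "B' \<in> blocks D"
    using nonfixed_block_orbit_eq[OF non mem] by metis
  obtain h where h: "h \<in> G" "snd h B = B'"
    using block_orbit_swap[of B B'] non B' by (metis (no_types, lifting) mem_Collect_eq)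
  have swap: "fst h a = b \<and> fst h b = a"
    if ab: "{a, b} \<in> point_orbits D G" "a \<noteq> b" and Bab: "incident D a B \<noteq> incident D b B" for a b
  proof -
    have a: "a \<in> points D" using point_orbit_subset[OF ab(1)] by simp
    have "incident D a B' = incident D b B"
      using separating_block_orbit(2)[OF ab Bb Bab] B' by (auto simp: doubleton_eq_iff)
    then have "fst h a \<noteq> a" using incident_image[OF h(1) a Bb] h(2) Bab by auto
    then show ?thesis
      using point_orbit_fix_or_swap[OF ab h(1)] by blast
  qed
  have hp: "fst h p = p'" "fst h p' = p" using swap[OF pp Bp] by auto
  have hs: "fst h s = s'" "fst h s' = s" using swap[OF ss Bs] by auto
  \<comment> \<open>The blocks through \<open>p\<close> and \<open>a\<close> are split by whether they contain \<open>p'\<close>.\<close>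
  let ?T = "\<lambda>a. {B \<in> blocks D. incident D p B \<and> incident D p' B \<and> incident D a B}"
  let ?S = "\<lambda>a. {B \<in> separating_blocks D p p'. incident D a B}"
  have le: "card (?T a) \<le> card (?T b)"
    if "fst h a = b" "a \<in> points D" "b \<in> points D" for a b
  proof (rule card_inj_on_le)
    have bij: "bij_betw (snd h) (blocks D) (blocks D)"
      using automorphism_groupD(2)[OF subgroup h(1)] by (simp add: Bij_def)
    show "inj_on (snd h) (?T a)"
      using bij by (auto simp: bij_betw_def intro: inj_on_subset)
    show "snd h ` ?T a \<subseteq> ?T b"
    proof safe
      fix C assume C: "C \<in> blocks D" "incident D p C" "incident D p' C" "incident D a C"
      show "snd h C \<in> blocks D" using bij C bij_betwE by blast
      show "incident D p (snd h C)" using incident_image[OF h(1) pts(2) C(1)] hp C by simp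
      show "incident D p' (snd h C)" using incident_image[OF h(1) pts(1) C(1)] hp C by simp
      show "incident D b (snd h C)" using incident_image[OF h(1) that(2) C(1)] that C by simp
    qed
    show "finite (?T b)" using fin by simp
  qed
  have T: "card (?T s) = card (?T s')"
    using le[of s s'] le[of s' s] hs pts by auto
  have S: "card (?S a) + card (?T a) = l" if a: "a \<in> points D" "p \<noteq> a" for a
  proof -
    have "card (?S a \<union> ?T a) = card (?S a) + card (?T a)"
      by (rule card_Un_disjoint) (use fin in \<open>auto simp: separating_blocks_def\<close>)
    moreover have "?S a \<union> ?T a = {B \<in> blocks D. incident D p B \<and> incident D a B}"
      by (auto simp: separating_blocks_def)
    ultimately show ?thesis using D pts(1) a by (simp add: two_design_def)
  qed
  have "card (?S s) = card (?S s')"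
    using S[OF pts(3) dist(1)] S[OF pts(4) dist(2)] T by simp
  moreover have "?X = {B \<in> ?S s \<union> ?S s'. (B \<in> ?S s) \<noteq> (B \<in> ?S s')}" by auto
  moreover have "finite (?S s)" "finite (?S s')" using fin by (auto simp: separating_blocks_def)
  ultimately have "card ?X + 2 * card (?S s \<inter> ?S s') = 2 * card (?S s')"
    using card_sym_diff_add_inter[of "?S s" "?S s'"] by simp
  then show ?thesis by presburger
next
  case True
  show ?thesis unfolding True by simp
qed

end

section \<open>Binary codes spanned by the rows of a matrix\<close>

lemma submodule_dual_code:
  assumes "C \<subseteq> carrier_vec n"
  shows "submodule class_ring (dual_code n C) (module_vec TYPE(bit) n)"
proof -
  interpret vec_space "TYPE(bit)" n .
  show ?thesis
    unfolding submodule_def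
  proof (intro conjI allI impI ballI)
    show "module class_ring (module_vec TYPE(bit) n)" by (rule module_axioms)
  qed (use assms in \<open>auto simp: dual_code_def module_vec_simps scalar_prod_add_distrib subset_iff\<close>)
qed

lemma of_nat_bit_eq_0_iff: "(of_nat n :: bit) = 0 \<longleftrightarrow> even n"
proof (cases "even n")
  case True
  then obtain k where "n = 2 * k" by (rule evenE)
  then show ?thesis by simp
next
  case False
  then obtain k where "n = 2 * k + 1" by (rule oddE)
  then show ?thesis by simp
qed

lemma of_nat_bit_eq_1_iff: "(of_nat n :: bit) = 1 \<longleftrightarrow> odd n"
  using of_nat_bit_eq_0_iff[of n] by (metis bit_not_zero_iff zero_neq_one)

lemma scalar_prod_bit:
  fixes u w :: "bit Matrix.vec"
  assumes "dim_vec w = n"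
  shows "scalar_prod u w = of_nat (card {i. i < n \<and> u $ i \<noteq> 0 \<and> w $ i \<noteq> 0})"
proof -
  have "scalar_prod u w = (\<Sum>i<n. of_bool (u $ i \<noteq> 0 \<and> w $ i \<noteq> 0))"
    unfolding scalar_prod_def assms atLeast0LessThan
    by (rule sum.cong) auto
  also have "\<dots> = of_nat (card {i. i < n \<and> u $ i \<noteq> 0 \<and> w $ i \<noteq> 0})"
    by (subst sum_of_bool_eq) (auto intro!: arg_cong[of _ _ "\<lambda>S. of_nat (card S)"])
  finally show ?thesis .
qed

lemma weight_add:
  assumes "u \<in> carrier_vec n" and "w \<in> carrier_vec n"
  shows "weight (u + w) + 2 * card {i. i < n \<and> u $ i \<noteq> 0 \<and> w $ i \<noteq> 0} = weight u + weight w"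
proof -
  let ?A = "{i. i < n \<and> u $ i \<noteq> 0}" and ?B = "{i. i < n \<and> w $ i \<noteq> 0}"
  have bit: "(a + b \<noteq> 0) \<longleftrightarrow> (a \<noteq> 0) \<noteq> (b \<noteq> 0)" for a b :: bit
    by (cases a; cases b) auto
  have "weight (u + w) = card {i \<in> ?A \<union> ?B. (i \<in> ?A) \<noteq> (i \<in> ?B)}"
    unfolding weight_def using assms bit by (intro arg_cong[of _ _ card]) auto
  moreover have "{i. i < n \<and> u $ i \<noteq> 0 \<and> w $ i \<noteq> 0} = ?A \<inter> ?B" by auto
  moreover have "weight u = card ?A" "weight w = card ?B"
    using assms by (auto simp: weight_def)
  ultimately show ?thesis using card_sym_diff_add_inter[of ?A ?B] by simp
qed

text \<open>The dual of any set is a subspace.  Orthogonality of \<open>S\<close> to itself is extended to the span in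
  one argument of the scalar product first, and then in the other.\<close>

lemma self_orthogonal_span:
  assumes S: "S \<subseteq> carrier_vec n" and orth: "\<And>u w. u \<in> S \<Longrightarrow> w \<in> S \<Longrightarrow> scalar_prod u w = 0"
  shows "self_orthogonal n (LinearCombinations.module.span class_ring (module_vec TYPE(bit) n) S)"
proof -
  interpret vec_space "TYPE(bit)" n .
  have carr: "span S \<subseteq> carrier_vec n" by (rule span_is_subset2[of S, unfolded module_vec_simps(3), OF S])
  have "span S \<subseteq> dual_code n S"
    by (rule span_is_subset[OF _ submodule_dual_code[OF S]]) (use S orth in \<open>auto simp: dual_code_def\<close>)
  then have "scalar_prod c w = 0" if c: "c \<in> span S" and w: "w \<in> S" for c w
  proof -
    have "c \<in> carrier_vec n" "w \<in> carrier_vec n" using c w S carr by blast+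
    moreover have "scalar_prod w c = 0"
      using c w \<open>span S \<subseteq> dual_code n S\<close> unfolding dual_code_def by blast
    ultimately show ?thesis by (metis comm_scalar_prod)
  qed
  then have "S \<subseteq> dual_code n (span S)"
    using S unfolding dual_code_def by blast
  then have "span S \<subseteq> dual_code n (span S)"
    by (rule span_is_subset[OF _ submodule_dual_code[OF carr]])
  then show ?thesis by (simp add: self_orthogonal_def)
qed

text \<open>For orthogonal \<open>u\<close>, \<open>w\<close> the supports meet in an even number of positions, so by \<open>weight_add\<close> the
  weight is additive modulo 4.  Within the span, where all words are orthogonal, the words of weight
  divisible by 4 therefore form a subspace.\<close>

lemma doubly_even_span:
  assumes S: "S \<subseteq> carrier_vec n" and orth: "\<And>u w. u \<in> S \<Longrightarrow> w \<in> S \<Longrightarrow> scalar_prod u w = 0"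
    and wt: "\<And>u. u \<in> S \<Longrightarrow> 4 dvd weight u"
  shows "doubly_even (LinearCombinations.module.span class_ring (module_vec TYPE(bit) n) S)"
proof -
  interpret vec_space "TYPE(bit)" n .
  have carr: "span S \<subseteq> carrier_vec n" by (rule span_is_subset2[of S, unfolded module_vec_simps(3), OF S])
  have so: "scalar_prod u w = 0" if "u \<in> span S" "w \<in> span S" for u w
  proof -
    have "self_orthogonal n (span S)" by (rule self_orthogonal_span[OF S orth])
    then show ?thesis using that unfolding self_orthogonal_def dual_code_def by blast
  qed
  interpret sub: submodule class_ring "span S" "module_vec TYPE(bit) n"
    by (rule span_is_submodule) (use S in \<open>simp add: module_vec_simps\<close>)
  have add: "4 dvd weight (u + w)" if "u \<in> span S" "w \<in> span S" "4 dvd weight u" "4 dvd weight w" for u w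
  proof -
    have uw: "u \<in> carrier_vec n" "w \<in> carrier_vec n" using that carr by auto
    have "even (card {i. i < n \<and> u $ i \<noteq> 0 \<and> w $ i \<noteq> 0})"
      using so[OF that(1,2)] uw scalar_prod_bit[of w n u] by (simp add: of_nat_bit_eq_0_iff)
    then show ?thesis using weight_add[OF uw] that(3,4) by presburger
  qed
  have zero_mem: "0\<^sub>v n \<in> {w \<in> span S. 4 dvd weight w}"
  proof -
    have "weight (0\<^sub>v n) = 0" by (simp add: weight_def cong: conj_cong)
    then show ?thesis using sub.zero_closed by (simp add: module_vec_simps)
  qed
  have "submodule class_ring {w \<in> span S. 4 dvd weight w} (module_vec TYPE(bit) n)"
    unfolding submodule_def
  proof (intro conjI allI impI ballI)
    show "module class_ring (module_vec TYPE(bit) n)" by (rule module_axioms)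
    show "{w \<in> span S. 4 dvd weight w} \<subseteq> carrier (module_vec TYPE(bit) n)"
      using carr unfolding module_vec_simps by blast
  next
    fix u w assume "u \<in> {w \<in> span S. 4 dvd weight w}" "w \<in> {w \<in> span S. 4 dvd weight w}"
    then show "u \<oplus>\<^bsub>module_vec TYPE(bit) n\<^esub> w \<in> {w \<in> span S. 4 dvd weight w}"
      using add[of u w] sub.m_closed[of u w] unfolding module_vec_simps by blast
  next
    show "\<zero>\<^bsub>module_vec TYPE(bit) n\<^esub> \<in> {w \<in> span S. 4 dvd weight w}"
      unfolding module_vec_simps by (rule zero_mem)
  next
    fix c w assume w: "w \<in> {w \<in> span S. 4 dvd weight w}"
    then have "w \<in> carrier_vec n" using carr by blast
    then have "0 \<cdot>\<^sub>v w = 0\<^sub>v n" "1 \<cdot>\<^sub>v w = w" by auto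
    then have "c \<cdot>\<^sub>v w = 0\<^sub>v n \<or> c \<cdot>\<^sub>v w = w" by (metis bit_not_zero_iff)
    then show "c \<odot>\<^bsub>module_vec TYPE(bit) n\<^esub> w \<in> {w \<in> span S. 4 dvd weight w}"
      using w zero_mem unfolding module_vec_simps by auto
  qed
  moreover have "S \<subseteq> {w \<in> span S. 4 dvd weight w}"
    using in_own_span[of S] S wt unfolding module_vec_simps by blast
  ultimately have "span S \<subseteq> {w \<in> span S. 4 dvd weight w}"
    by (intro span_is_subset)
  then show ?thesis unfolding doubly_even_def by blast
qed

text \<open>The case \<open>i = i'\<close> of the hypothesis says that every row has even weight.\<close>

lemma binary_row_code_criteria:
  assumes inner: "\<And>i i'. i < dim_row N \<Longrightarrow> i' < dim_row N \<Longrightarrow>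
      even (card {j. j < dim_col N \<and> odd (N $$ (i, j)) \<and> odd (N $$ (i', j))})"
  shows "self_orthogonal (dim_col N) (binary_row_code N)"
    and "(\<And>i. i < dim_row N \<Longrightarrow> 4 dvd card {j. j < dim_col N \<and> odd (N $$ (i, j))})
      \<Longrightarrow> doubly_even (binary_row_code N)"
proof -
  let ?S = "set (rows (map_mat of_nat N :: bit mat))"
  have S: "?S \<subseteq> carrier_vec (dim_col N)" using rows_carrier[of "map_mat of_nat N :: bit mat"] by simp
  have row: "\<exists>i<dim_row N. dim_vec u = dim_col N \<and> (\<forall>j<dim_col N. u $ j = of_nat (N $$ (i, j)))"
    if u: "u \<in> ?S" for u
  proof -
    obtain i where "i < dim_row N" "u = Matrix.row (map_mat of_nat N) i"
      using u by (auto simp: rows_def)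
    then show ?thesis by (intro exI[of _ i]) simp
  qed
  have orth: "scalar_prod u w = 0" if uw: "u \<in> ?S" "w \<in> ?S" for u w
  proof -
    obtain i i' where i: "i < dim_row N" "\<forall>j<dim_col N. u $ j = of_nat (N $$ (i, j))"
      and i': "i' < dim_row N" "dim_vec w = dim_col N" "\<forall>j<dim_col N. w $ j = of_nat (N $$ (i', j))"
      using row[OF uw(1)] row[OF uw(2)] by blast
    have "{j. j < dim_col N \<and> u $ j \<noteq> 0 \<and> w $ j \<noteq> 0} =
        {j. j < dim_col N \<and> odd (N $$ (i, j)) \<and> odd (N $$ (i', j))}"
      using i i' by (auto simp: of_nat_bit_eq_1_iff)
    then show ?thesis using scalar_prod_bit[OF i'(2), of u] inner[OF i(1) i'(1)]
      by (simp add: of_nat_bit_eq_0_iff)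
  qed
  show "self_orthogonal (dim_col N) (binary_row_code N)"
    unfolding binary_row_code_def vec_space.row_space_def by (rule self_orthogonal_span[OF S orth])
  assume wt: "\<And>i. i < dim_row N \<Longrightarrow> 4 dvd card {j. j < dim_col N \<and> odd (N $$ (i, j))}"
  have "4 dvd weight u" if u: "u \<in> ?S" for u
  proof -
    obtain i where i: "i < dim_row N" "dim_vec u = dim_col N" "\<forall>j<dim_col N. u $ j = of_nat (N $$ (i, j))"
      using row[OF u] by blast
    have "{j. j < dim_vec u \<and> u $ j \<noteq> 0} = {j. j < dim_col N \<and> odd (N $$ (i, j))}"
      using i by (auto simp: of_nat_bit_eq_1_iff)
    then show ?thesis using wt[OF i(1)] by (simp add: weight_def)
  qed
  then show "doubly_even (binary_row_code N)"
    unfolding binary_row_code_def vec_space.row_space_def by (intro doubly_even_span[OF S orth])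
qed

section \<open>The non-fixed part of the point orbit matrix\<close>

lemma bij_betw_nth_pick:
  assumes "distinct xs"
  shows "bij_betw (\<lambda>j. xs ! pick {j. j < length xs \<and> Q (xs ! j)} j)
           {j. j < card {j. j < length xs \<and> Q (xs ! j)}} {x \<in> set xs. Q x}"
proof -
  let ?J = "{j. j < length xs \<and> Q (xs ! j)}"
  have sub: "pick ?J ` {j. j < card ?J} \<subseteq> ?J" using pick_in_set_le by blast
  have inj: "inj_on (pick ?J) {j. j < card ?J}"
  proof (rule linorder_inj_onI)
    fix i j assume "i < j" "i \<in> {j. j < card ?J}" "j \<in> {j. j < card ?J}"
    then show "pick ?J i \<noteq> pick ?J j" using pick_mono_le[of j ?J i] by simp
  qed auto
  have "bij_betw (pick ?J) {j. j < card ?J} ?J"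
    using sub inj by (simp add: bij_betw_def card_image card_subset_eq)
  moreover have "bij_betw ((!) xs) ?J {x \<in> set xs. Q x}"
    using assms by (auto simp: bij_betw_def inj_on_def nth_eq_iff_index_eq in_set_conv_nth)
  ultimately show ?thesis using bij_betw_trans by (fastforce simp: o_def)
qed

text \<open>Replaces the selection of rows and columns by position with enumerations \<open>\<rho>\<close> and \<open>\<kappa>\<close> of the
  non-fixed orbits, so that counting columns becomes counting block orbits.\<close>

lemma non_fixed_part_point_orbit_matrix:
  assumes "N = non_fixed_part Ps Bs (point_orbit_matrix D Ps Bs)" and "distinct Ps" and "distinct Bs"
  obtains \<rho> \<kappa> where
    "bij_betw \<rho> {i. i < dim_row N} {P \<in> set Ps. card P > 1}"
    "bij_betw \<kappa> {j. j < dim_col N} {\<O> \<in> set Bs. card \<O> > 1}"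
    "\<forall>i<dim_row N. \<forall>j<dim_col N.
       N $$ (i, j) = card {B \<in> \<kappa> j. incident D (SOME p. p \<in> \<rho> i) B}"
proof -
  let ?M = "point_orbit_matrix D Ps Bs"
  let ?I = "{i. i < length Ps \<and> card (Ps ! i) > 1}" and ?J = "{j. j < length Bs \<and> card (Bs ! j) > 1}"
  have N: "N = submatrix ?M ?I ?J" by (simp add: assms(1) non_fixed_part_def)
  have "{i. i < dim_row ?M \<and> i \<in> ?I} = ?I" "{j. j < dim_col ?M \<and> j \<in> ?J} = ?J"
    by (auto simp: point_orbit_matrix_def)
  then have dim: "dim_row N = card ?I" "dim_col N = card ?J"
    unfolding N dim_submatrix by simp_all
  show ?thesis
  proof (rule that)
    show "bij_betw (\<lambda>i. Ps ! pick ?I i) {i. i < dim_row N} {P \<in> set Ps. card P > 1}"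
      unfolding dim using bij_betw_nth_pick[OF assms(2), of "\<lambda>x. card x > 1"] .
    show "bij_betw (\<lambda>j. Bs ! pick ?J j) {j. j < dim_col N} {\<O> \<in> set Bs. card \<O> > 1}"
      unfolding dim using bij_betw_nth_pick[OF assms(3), of "\<lambda>x. card x > 1"] .
  next
    show "\<forall>i<dim_row N. \<forall>j<dim_col N. N $$ (i, j)
        = card {B \<in> Bs ! pick ?J j. incident D (SOME p. p \<in> Ps ! pick ?I i) B}"
    proof (intro allI impI)
      fix i j assume ij: "i < dim_row N" "j < dim_col N"
      then have "pick ?I i \<in> ?I" "pick ?J j \<in> ?J"
        unfolding dim using pick_in_set_le by blast+
      moreover have "N $$ (i, j) = ?M $$ (pick ?I i, pick ?J j)"
        unfolding N by (rule submatrix_index) (use ij N in \<open>simp_all add: dim_submatrix\<close>)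
      ultimately show "N $$ (i, j) = card {B \<in> Bs ! pick ?J j. incident D (SOME p. p \<in> Ps ! pick ?I i) B}"
        by (simp add: point_orbit_matrix_def)
    qed
  qed
qed

lemma card_Collect_bij_betw:
  assumes "bij_betw f {j. j < n} A"
  shows "card {j. j < n \<and> Q (f j)} = card {x \<in> A. Q x}"
proof (rule bij_betw_same_card)
  show "bij_betw f {j. j < n \<and> Q (f j)} {x \<in> A. Q x}"
    using assms by (auto simp: bij_betw_def inj_on_def)
qed

text \<open>The divisor \<open>d\<close> of \<open>v\<close> and \<open>k\<close> controls the row weights, which are multiples of \<open>d\<close>: an even \<open>d\<close> makes
  each row orthogonal to itself.  Distinct rows are orthogonal by \<open>even_common_separating_blocks\<close>.\<close>

theorem orbit_matrix_code:
  assumes des: "two_design D v k l"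
    and sub: "subgroup G (automorphism_group D)"
    and P2: "\<forall>P\<in>point_orbits D G. card P \<noteq> 1 \<longrightarrow> card P = 2"
    and B2: "\<forall>B\<in>block_orbits D G. card B \<noteq> 1 \<longrightarrow> card B = 2"
    and Ps: "enumerates Ps (point_orbits D G)" and Bs: "enumerates Bs (block_orbits D G)"
    and N: "N = non_fixed_part Ps Bs (point_orbit_matrix D Ps Bs)"
    and d: "d dvd v" "d dvd k"
  shows "even d \<Longrightarrow> self_orthogonal (dim_col N) (binary_row_code N)"
    and "4 dvd d \<Longrightarrow> doubly_even (binary_row_code N)"
proof -
  interpret automorphism_group_short_block_orbits D G
    by (rule automorphism_group_short_block_orbits.intro[OF sub]) (use B2 in blast)
  have set: "set Ps = point_orbits D G" "set Bs = block_orbits D G" "distinct Ps" "distinct Bs"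
    using Ps Bs by (auto simp: enumerates_def)
  obtain \<rho> \<kappa> where \<rho>: "bij_betw \<rho> {i. i < dim_row N} {P \<in> point_orbits D G. card P > 1}"
    and \<kappa>: "bij_betw \<kappa> {j. j < dim_col N} nonfixed_block_orbits"
    and entry: "\<forall>i<dim_row N. \<forall>j<dim_col N.
       N $$ (i, j) = card {B \<in> \<kappa> j. incident D (SOME p. p \<in> \<rho> i) B}"
    by (rule non_fixed_part_point_orbit_matrix[OF N set(3,4), unfolded set])
  define rep where "rep i = (SOME p. p \<in> \<rho> i)" for i
  have "\<exists>p'. \<rho> i = {rep i, p'} \<and> rep i \<noteq> p'" if i: "i < dim_row N" for i
  proof -
    have "\<rho> i \<in> {P \<in> point_orbits D G. card P > 1}" using bij_betwE[OF \<rho>] i by blast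
    then have c: "card (\<rho> i) = 2" using P2 by force
    then have "\<rho> i \<noteq> {}" by auto
    then have "rep i \<in> \<rho> i" unfolding rep_def by (simp add: some_in_eq)
    then show ?thesis using card_2_other[OF c] by metis
  qed
  then obtain other where other: "\<And>i. i < dim_row N \<Longrightarrow> \<rho> i = {rep i, other i} \<and> rep i \<noteq> other i"
    by metis
  have orb: "{rep i, other i} \<in> point_orbits D G" "rep i \<noteq> other i" if "i < dim_row N" for i
    using other[OF that] bij_betwE[OF \<rho>] that by auto
  have wt: "d dvd card {j. j < dim_col N \<and> odd (N $$ (i, j))}" if i: "i < dim_row N" for i
  proof -
    have "{j. j < dim_col N \<and> odd (N $$ (i, j))}
        = {j. j < dim_col N \<and> odd (card {B \<in> \<kappa> j. incident D (rep i) B})}"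
      using entry i by (auto simp: rep_def)
    also have "card \<dots> = card (separating_blocks D (rep i) (other i))"
      unfolding card_Collect_bij_betw[OF \<kappa>, of "\<lambda>\<O>. odd (card {B \<in> \<O>. incident D (rep i) B})"]
      by (rule card_odd_entries[OF orb[OF i]])
    finally show ?thesis
      using dvd_card_separating_blocks[OF des _ _ orb(2)[OF i] d] point_orbit_subset[OF orb(1)[OF i]]
      by simp
  qed
  have inner: "even (card {j. j < dim_col N \<and> odd (N $$ (i, j)) \<and> odd (N $$ (i', j))})"
    if d2: "even d" and i: "i < dim_row N" and i': "i' < dim_row N" for i i'
  proof (cases "i = i'")
    case True
    then show ?thesis using wt[OF i] d2 dvd_trans by auto
  next
    case False
    then have "\<rho> i \<noteq> \<rho> i'" using \<rho> i i' by (auto simp: bij_betw_def inj_on_def)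
    then have ne: "{rep i, other i} \<noteq> {rep i', other i'}" using other[OF i] other[OF i'] by simp
    have "{j. j < dim_col N \<and> odd (N $$ (i, j)) \<and> odd (N $$ (i', j))}
        = {j. j < dim_col N \<and> odd (card {B \<in> \<kappa> j. incident D (rep i) B}) \<and>
              odd (card {B \<in> \<kappa> j. incident D (rep i') B})}"
      using entry i i' by (auto simp: rep_def)
    also have "card \<dots> = card {B \<in> separating_blocks D (rep i) (other i).
          incident D (rep i') B \<noteq> incident D (other i') B}"
      unfolding card_Collect_bij_betw[OF \<kappa>, of "\<lambda>\<O>. odd (card {B \<in> \<O>. incident D (rep i) B}) \<and>
          odd (card {B \<in> \<O>. incident D (rep i') B})"]
      by (rule card_common_odd_entries[OF orb[OF i] orb[OF i']])
    finally show ?thesis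
      using even_common_separating_blocks[OF des orb[OF i] orb[OF i'] ne] by simp
  qed
  show "self_orthogonal (dim_col N) (binary_row_code N)" if "even d"
    using binary_row_code_criteria(1) inner[OF that] by blast
  show "doubly_even (binary_row_code N)" if "4 dvd d"
  proof (rule binary_row_code_criteria(2))
    have "even d" using that by presburger
    then show "even (card {j. j < dim_col N \<and> odd (N $$ (i, j)) \<and> odd (N $$ (i', j))})"
      if "i < dim_row N" "i' < dim_row N" for i i' using inner that by blast
    show "4 dvd card {j. j < dim_col N \<and> odd (N $$ (i, j))}" if "i < dim_row N" for i
      using wt[OF that] \<open>4 dvd d\<close> dvd_trans by blast
  qed
qed

section \<open>Block sizes in designs of Blokhuis-Haemers type\<close>

lemma card_subspace_dim_1:
  fixes W :: "('a::{field,finite} ^ 'n) set"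
  assumes "vec.subspace W" and "vec.dim W = 1"
  shows "card W = CARD('a)"
proof -
  obtain S where S: "S \<subseteq> W" "vec.independent S" "W \<subseteq> vec.span S" "card S = 1"
    using vec.basis_exists[of W] assms(2) by metis
  then obtain b where b: "S = {b}" by (auto simp: card_1_singleton_iff)
  have "vec.span S = W"
    using S assms(1) vec.span_minimal by blast
  then have W: "W = range (\<lambda>c. c *s b)" by (simp add: b vec.span_singleton)
  have "b \<noteq> 0" using S(2) b vec.dependent_zero by blast
  then have "inj (\<lambda>c. c *s b)" by (auto simp: inj_on_def)
  then show ?thesis unfolding W by (simp add: card_image)
qed

lemma parallel_class_lines:
  assumes "P \<in> (parallel_classes :: ('a::{field,finite} ^ 'n) set set set)"
  shows "L \<in> P \<Longrightarrow> card L = CARD('a)" and "L \<in> P \<Longrightarrow> L' \<in> P \<Longrightarrow> L \<noteq> L' \<Longrightarrow> L \<inter> L' = {}"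
proof -
  obtain W where W: "P = range (\<lambda>p. (+) p ` W)" "vec.subspace W" "vec.dim W = 1"
    using assms by (auto simp: parallel_classes_def)
  show "card L = CARD('a)" if "L \<in> P"
    using that W card_subspace_dim_1[of W] by (auto simp: card_image)
  assume "L \<in> P" "L' \<in> P" "L \<noteq> L'"
  then obtain p p' where pp: "L = (+) p ` W" "L' = (+) p' ` W" using W by auto
  have coset: "(+) a ` W = {z. z - a \<in> W}" for a
    by (auto simp: image_iff) (metis add.commute diff_add_cancel)
  show "L \<inter> L' = {}"
  proof (rule ccontr)
    assume "L \<inter> L' \<noteq> {}"
    then obtain z where z: "z - p \<in> W" "z - p' \<in> W" unfolding pp coset by blast
    have d: "p - p' \<in> W" using vec.subspace_diff[OF W(2) z(2,1)] by simp
    have "x - p' \<in> W" if "x - p \<in> W" for x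
      using vec.subspace_add[OF W(2) that d] by simp
    moreover have "x - p \<in> W" if "x - p' \<in> W" for x
      using vec.subspace_diff[OF W(2) that d] by simp
    ultimately have "L = L'" unfolding pp coset by blast
    then show False using \<open>L \<noteq> L'\<close> by simp
  qed
qed

text \<open>A block is a disjoint union of \<open>q (q - 1) / 2\<close> parallel lines with \<open>q\<close> points each.\<close>

lemma blokhuis_haemers_block_card:
  fixes D :: "('a::{field,finite} ^ 3, ('a ^ 3) set) incidence_structure"
  assumes "blokhuis_haemers_type D" and "X \<in> blocks D"
  shows "card {p \<in> points D. incident D p X} = CARD('a) * (CARD('a) - 1) div 2 * CARD('a)"
proof -
  obtain \<B> :: "('a ^ 2) set set" and \<phi> :: "('a ^ 3) set set \<Rightarrow> 'a ^ 2 \<Rightarrow> ('a ^ 3) set" where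
    arc: "\<forall>B\<in>\<B>. maximal_arc CARD('a) UNIV (ag_flats 1) B"
    and lab: "\<forall>P\<in>parallel_classes. bij_betw (\<phi> P) UNIV P"
    and D: "D = set_structure UNIV {\<Union>(\<phi> P ` B) | P B. P \<in> parallel_classes \<and> B \<in> \<B>}"
    using assms(1) unfolding blokhuis_haemers_type_def Let_def by blast
  obtain P B where X: "X = \<Union>(\<phi> P ` B)" and P: "P \<in> parallel_classes" and B: "B \<in> \<B>"
    using assms(2) by (auto simp: D set_structure_def)
  have bij: "bij_betw (\<phi> P) UNIV P" using lab P by blast
  have "card X = (\<Sum>L\<in>\<phi> P ` B. card L)"
    unfolding X
  proof (rule card_Union_disjoint)
    show "pairwise disjnt (\<phi> P ` B)"
      unfolding pairwise_def disjnt_def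
      using parallel_class_lines(2)[OF P] bij_betwE[OF bij] by blast
  qed simp
  also have "\<dots> = (\<Sum>L\<in>\<phi> P ` B. CARD('a))"
    by (rule sum.cong) (use bij parallel_class_lines(1)[OF P] in \<open>auto simp: bij_betw_def\<close>)
  also have "\<dots> = card B * CARD('a)"
    using card_image[OF inj_on_subset[OF bij_betw_imp_inj_on[OF bij], of B]] by simp
  finally show ?thesis using arc B by (simp add: D set_structure_def maximal_arc_def)
qed

text \<open>Quasi-symmetry provides some \<open>k\<close> without naming it; one block is enough to read off its value.\<close>

lemma blokhuis_haemers_blocks_nonempty:
  fixes D :: "('a::{field,finite} ^ 3, ('a ^ 3) set) incidence_structure"
  assumes "blokhuis_haemers_type D"
  shows "blocks D \<noteq> {}"
proof -
  obtain \<B> :: "('a ^ 2) set set" and \<phi> :: "('a ^ 3) set set \<Rightarrow> 'a ^ 2 \<Rightarrow> ('a ^ 3) set" where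
    sym: "card \<B> = CARD('a)\<^sup>2"
    and D: "D = set_structure UNIV {\<Union>(\<phi> P ` B) | P B. P \<in> parallel_classes \<and> B \<in> \<B>}"
    using assms(1) unfolding blokhuis_haemers_type_def Let_def symmetric_design_def
    by (auto simp: set_structure_def)
  have "\<B> \<noteq> {}" using sym by auto
  moreover have "(parallel_classes :: ('a ^ 3) set set set) \<noteq> {}"
  proof -
    have "axis 1 1 \<noteq> (0 :: 'a ^ 3)" by (simp add: axis_eq_0_iff)
    then have "vec.dim (vec.span {axis 1 1 :: 'a ^ 3}) = 1"
      by (simp add: vec.dim_eq_card_independent)
    then show ?thesis unfolding parallel_classes_def using vec.subspace_span by blast
  qed
  ultimately show ?thesis by (auto simp: D set_structure_def)
qed

theorem theorem4p5:
  fixes q f h :: nat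
    and D :: "('a::{field,finite} ^ 3, ('a ^ 3) set) incidence_structure"
    and G :: "(('a ^ 3 \<Rightarrow> 'a ^ 3) \<times> (('a ^ 3) set \<Rightarrow> ('a ^ 3) set)) set"
    and Ps :: "('a ^ 3) set list"
    and Bs :: "('a ^ 3) set set list"
    and M N :: "nat mat"
    and C :: "bit Matrix.vec set"
  assumes "q \<ge> 2" and "\<exists>m. q = 2 ^ m" and "CARD('a) = q"
    and "quasi_symmetric_design D" and "blokhuis_haemers_type D"
    and "subgroup G (automorphism_group D)"
    and "card (fixed_points D G) = f" and "card (fixed_blocks D G) = h"
    and "\<forall>P\<in>point_orbits D G. card P \<noteq> 1 \<longrightarrow> card P = 2"
    and "\<forall>B\<in>block_orbits D G. card B \<noteq> 1 \<longrightarrow> card B = 2"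
    and "enumerates Ps (point_orbits D G)" and "enumerates Bs (block_orbits D G)"
    and "M = point_orbit_matrix D Ps Bs"
    and "N = non_fixed_part Ps Bs M"
    and "C = binary_row_code N"
  shows "self_orthogonal (dim_col N) C \<and> (q \<ge> 4 \<longrightarrow> doubly_even C)"
proof -
  obtain v k l where des: "two_design D v k l"
    using assms(4) by (auto simp: quasi_symmetric_design_def)
  obtain X where X: "X \<in> blocks D" using blokhuis_haemers_blocks_nonempty[OF assms(5)] by blast
  have k: "k = q * (q - 1) div 2 * q"
    using blokhuis_haemers_block_card[OF assms(5) X] des X assms(3) by (simp add: two_design_def)
  have "points D = UNIV"
    using assms(5) by (auto simp: blokhuis_haemers_type_def Let_def set_structure_def)
  then have v: "v = q ^ 3" using des assms(3) by (simp add: two_design_def)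
  obtain m where m: "q = 2 ^ m" using assms(2) by blast
  then obtain e where q: "q = 2 * e" and e: "q \<ge> 4 \<Longrightarrow> even e"
  proof -
    have "m \<noteq> 0" using m assms(1) by (intro notI) simp
    then obtain m' where m': "m = Suc m'" using not0_implies_Suc by blast
    moreover have "even ((2::nat) ^ m')" if "q \<ge> 4"
      using that m m' by (cases m') auto
    ultimately show ?thesis using that[of "2 ^ m'"] m by simp
  qed
  \<comment> \<open>\<open>2 * e\<^sup>2\<close> is \<open>q\<^sup>2 / 2\<close>.\<close>
  have d: "2 * e\<^sup>2 dvd v" "2 * e\<^sup>2 dvd k"
    by (simp_all add: v k q power2_eq_square power3_eq_cube)
  note code = orbit_matrix_code[OF des assms(6,9,10,11,12) assms(14)[unfolded assms(13)] d]
  have "4 dvd 2 * e\<^sup>2" if "q \<ge> 4"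
    using e[OF that] by (auto elim!: evenE simp: power2_eq_square)
  then show ?thesis using code assms(15) by simp
qed

end
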